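(* For every integer $n\geq2$, $p_{3,n}(n)-p_{1,n-1}(n)=0$; and for every integer $n\geq1$, $p_{3,n+1}(n)-p_{1,n}(n)=1$.
   Context: A partition of $n$ is a finite multiset of positive integers summing to $n$. For positive integers $A,a$ and a partition $\pi$, $\mathrm{mex}_{A,a}(\pi)$ is the smallest element of $\{a,a+A,a+2A,\dots\}$ that is not a part of $\pi$. $p_{A,a}(n)$ is the number of partitions $\pi$ of $n$ with $\mathrm{mex}_{A,a}(\pi)\equiv a \pmod{2A}$. *)

theory Defs
  imports "HOL-Library.Multiset" "HOL-Number_Theory.Cong"
begin

definition partitions :: "nat \<Rightarrow> nat multiset set" where
  "partitions n = {\<pi>. (\<forall>i \<in># \<pi>. 0 < i) \<and> sum_mset \<pi> = n}"

text \<open>The least element exists, since a multiset has only finitely many distinct members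
  and the progression is infinite for positive difference \<open>A\<close>. The definition is meant for
  positive \<open>A\<close> and \<open>a\<close> only.\<close>

definition mex :: "nat \<Rightarrow> nat \<Rightarrow> nat multiset \<Rightarrow> nat" where
  "mex A a \<pi> = (LEAST m. m \<in> {a + k * A | k. True} \<and> m \<notin># \<pi>)"

definition p :: "nat \<Rightarrow> nat \<Rightarrow> nat \<Rightarrow> nat" where
  "p A a n = card {\<pi> \<in> partitions n. [mex A a \<pi> = a] (mod (2 * A))}"

text \<open>The cardinality above is not the default value of an infinite set.\<close>

lemma finite_partitions: "finite (partitions n)"
proof -
  have size_le: "size M \<le> sum_mset M" if "\<forall>i \<in># M. 0 < i" for M :: "nat multiset"
    using that by (induction M) auto
  have mem_le: "i \<le> sum_mset M" if "i \<in># M" for i and M :: "nat multiset"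
    using that by (metis le_add1 multi_member_split sum_mset.add_mset)
  have "partitions n \<subseteq> mset ` {xs. set xs \<subseteq> {..n} \<and> length xs \<le> n}"
  proof
    fix M assume M: "M \<in> partitions n"
    obtain xs where xs: "M = mset xs" by (metis ex_mset)
    have "set xs \<subseteq> {..n}"
      using M mem_le[of _ M] by (auto simp: partitions_def xs)
    moreover have "length xs \<le> n"
      using M size_le[of M] by (simp add: partitions_def xs)
    ultimately show "M \<in> mset ` {xs. set xs \<subseteq> {..n} \<and> length xs \<le> n}"
      using xs by blast
  qed
  moreover have "finite {xs. set xs \<subseteq> {..n} \<and> length xs \<le> n}"
    by (rule finite_lists_length_le) simp
  ultimately show ?thesis
    by (meson finite_imageI finite_subset)
qed

end

theory Submission
  imports Defs
begin

text \<open>If \<open>2 * a + A > n\<close>, a partition of \<open>n\<close> cannot contain both \<open>a\<close> and \<open>a + A\<close>,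
  so its mex is \<open>a\<close> or \<open>a + A\<close>, and \<open>p A a n\<close> counts the partitions of \<open>n\<close> without the part \<open>a\<close>.
  Removing one \<open>a\<close> puts the others in bijection with the partitions of \<open>n - a\<close>. In all
  four terms of the theorem \<open>a \<ge> n - 1\<close>, so that \<open>n - a \<le> 1\<close> whenever \<open>a \<le> n\<close>.\<close>

lemma mex_eq_first:
  assumes "a \<notin># \<pi>"
  shows "mex A a \<pi> = a"
  unfolding mex_def
proof (rule Least_equality)
  show "a \<in> {a + k * A |k. True} \<and> a \<notin># \<pi>"
    using assms by (auto intro: exI[of _ 0])
qed auto

lemma mex_eq_second:
  assumes "a \<in># \<pi>" "a + A \<notin># \<pi>"
  shows "mex A a \<pi> = a + A"
  unfolding mex_def
proof (rule Least_equality)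
  show "a + A \<in> {a + k * A |k. True} \<and> a + A \<notin># \<pi>"
    using assms by (auto intro: exI[of _ 1])
next
  fix m assume "m \<in> {a + k * A |k. True} \<and> m \<notin># \<pi>"
  then obtain k where "m = a + k * A" "m \<notin># \<pi>" by auto
  with assms have "k \<noteq> 0" by (cases k) auto
  with \<open>m = a + k * A\<close> show "a + A \<le> m" by (cases k) auto
qed

text \<open>Removing one copy of \<open>a\<close> leaves a multiset of positive parts with sum
  \<open>n - a\<close>. For the way back, \<open>0 < a\<close> keeps all parts positive and
  \<open>a \<le> n\<close> ensures that the truncated difference gives back
  \<open>n\<close>.\<close>

lemma partitions_with_part:
  assumes "0 < a" "a \<le> n"
  shows "{\<pi> \<in> partitions n. a \<in># \<pi>} = add_mset a ` partitions (n - a)"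
proof (intro equalityI subsetI)
  fix \<pi> assume "\<pi> \<in> {\<pi> \<in> partitions n. a \<in># \<pi>}"
  then obtain \<rho> where "\<pi> = add_mset a \<rho>" "\<pi> \<in> partitions n"
    by (auto dest: multi_member_split)
  then show "\<pi> \<in> add_mset a ` partitions (n - a)"
    by (auto simp: partitions_def)
next
  fix \<pi> assume "\<pi> \<in> add_mset a ` partitions (n - a)"
  then show "\<pi> \<in> {\<pi> \<in> partitions n. a \<in># \<pi>}"
    using assms by (auto simp: partitions_def)
qed

lemma partition_part_le: "\<pi> \<in> partitions n \<Longrightarrow> i \<in># \<pi> \<Longrightarrow> i \<le> n"
  by (auto simp: partitions_def dest: multi_member_split)

text \<open>Cancelling \<open>a\<close> would leave \<open>2 * A\<close> dividing the smaller
  positive number \<open>A\<close>. Hence partitions whose mex is \<open>a + A\<close> are not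
  counted by \<open>p A a\<close>.\<close>

lemma not_cong_add_half_modulus:
  fixes a A :: nat
  assumes "0 < A"
  shows "\<not> [a + A = a] (mod (2 * A))"
proof
  assume "[a + A = a] (mod (2 * A))"
  then have "[A = 0] (mod (2 * A))" by (simp add: cong_add_lcancel_0_nat)
  with assms show False by (simp add: cong_0_iff nat_dvd_not_less)
qed

lemma p_eq_card_without_part:
  assumes "0 < A" "n < 2 * a + A"
  shows "p A a n = card {\<pi> \<in> partitions n. a \<notin># \<pi>}"
proof -
  have "[mex A a \<pi> = a] (mod (2 * A)) \<longleftrightarrow> a \<notin># \<pi>" if \<pi>: "\<pi> \<in> partitions n" for \<pi>
  proof (cases "a \<in># \<pi>")
    case False
    then show ?thesis by (simp add: mex_eq_first)
  next
    case True
    have "a + A \<notin># \<pi>"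
    proof
      assume second: "a + A \<in># \<pi>"
      obtain \<rho> where \<rho>: "\<pi> = add_mset a \<rho>" using True by (auto dest: multi_member_split)
      \<comment> \<open>Since \<open>0 < A\<close>, the part \<open>a + A\<close> differs from the
        removed \<open>a\<close>, so it survives in \<open>\<rho>\<close> and the two together
        contribute \<open>2 * a + A > n\<close>.\<close>
      with second assms(1) have "a + A \<in># \<rho>" by auto
      then obtain \<sigma> where "\<rho> = add_mset (a + A) \<sigma>" by (auto dest: multi_member_split)
      with \<rho> \<pi> assms(2) show False by (auto simp: partitions_def)
    qed
    with True assms(1) show ?thesis
      by (simp add: mex_eq_second not_cong_add_half_modulus)
  qed
  then have "{\<pi> \<in> partitions n. [mex A a \<pi> = a] (mod (2 * A))} = {\<pi> \<in> partitions n. a \<notin># \<pi>}"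
    by auto
  then show ?thesis by (simp add: p_def)
qed

lemma p_eq_card_partitions:
  assumes "0 < A" "n < a"
  shows "p A a n = card (partitions n)"
proof -
  have "{\<pi> \<in> partitions n. a \<notin># \<pi>} = partitions n"
    using assms(2) by (auto dest: partition_part_le)
  then show ?thesis using assms by (simp add: p_eq_card_without_part)
qed

text \<open>Splits the partitions of \<open>n\<close> by whether \<open>a\<close> occurs. The
  additive form avoids truncated subtraction.\<close>

lemma p_add_card_partitions:
  assumes "0 < A" "0 < a" "a \<le> n" "n < 2 * a + A"
  shows "p A a n + card (partitions (n - a)) = card (partitions n)"
proof -
  have "card {\<pi> \<in> partitions n. a \<in># \<pi>} = card (partitions (n - a))"
    using assms by (simp add: partitions_with_part card_image inj_on_def)
  moreover have "card (partitions n) =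
      card {\<pi> \<in> partitions n. a \<notin># \<pi>} + card {\<pi> \<in> partitions n. a \<in># \<pi>}"
    \<comment> \<open>The sum is folded into the cardinality of a disjoint union, which relies on
      finiteness.\<close>
    by (subst card_Un_disjoint [symmetric])
       (auto simp: finite_partitions intro: arg_cong[where f = card])
  ultimately show ?thesis
    using assms by (simp add: p_eq_card_without_part)
qed

lemma partitions_0: "partitions 0 = {{#}}"
proof -
  have "\<pi> = {#}" if "\<pi> \<in> partitions 0" for \<pi>
    using that by (cases \<pi>) (auto simp: partitions_def)
  then show ?thesis by (auto simp: partitions_def)
qed

lemma partitions_1: "partitions 1 = {{#1#}}"
proof -
  have "\<pi> = {#1#}" if \<pi>: "\<pi> \<in> partitions 1" for \<pi>
  proof (cases \<pi>)
    case empty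
    with \<pi> show ?thesis by (simp add: partitions_def)
  next
    case (add x \<rho>)
    with \<pi> have "0 < x" "x + sum_mset \<rho> = 1" and pos: "\<forall>i \<in># \<rho>. 0 < i"
      by (auto simp: partitions_def)
    then have "x = 1" "sum_mset \<rho> = 0" by linarith+
    with pos have "\<rho> \<in> partitions 0" unfolding partitions_def by blast
    with add \<open>x = 1\<close> show ?thesis by (simp add: partitions_0)
  qed
  then show ?thesis by (auto simp: partitions_def)
qed

theorem theorem5p4:
  shows "(\<forall>n::nat. 2 \<le> n \<longrightarrow> int (p 3 n n) - int (p 1 (n - 1) n) = 0) \<and>
         (\<forall>n::nat. 1 \<le> n \<longrightarrow> int (p 3 (n + 1) n) - int (p 1 n n) = 1)"
proof (intro conjI allI impI)
  fix n :: nat assume n: "2 \<le> n"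
  have "p 3 n n + 1 = card (partitions n)"
    using p_add_card_partitions[of 3 n n] n by (simp add: partitions_0)
  \<comment> \<open>With \<open>A = 1\<close> and \<open>a = n - 1\<close>, the bound
    \<open>n < 2 * a + A\<close> reads \<open>n < 2 * n - 1\<close>, which is exactly
    \<open>2 \<le> n\<close>.\<close>
  moreover have "p 1 (n - 1) n + card (partitions (n - (n - 1))) = card (partitions n)"
    using n by (intro p_add_card_partitions) auto
  then have "p 1 (n - 1) n + 1 = card (partitions n)"
    using n partitions_1 by simp
  ultimately show "int (p 3 n n) - int (p 1 (n - 1) n) = 0" by simp
next
  fix n :: nat assume n: "1 \<le> n"
  \<comment> \<open>No partition of \<open>n\<close> has the part \<open>n + 1\<close>, whereas
    \<open>p 1 n n\<close> misses just \<open>{#n#}\<close>; this accounts for the difference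
    1.\<close>
  have "p 3 (n + 1) n = card (partitions n)"
    by (simp add: p_eq_card_partitions)
  moreover have "p 1 n n + 1 = card (partitions n)"
    using p_add_card_partitions[of 1 n n] n by (simp add: partitions_0)
  ultimately show "int (p 3 (n + 1) n) - int (p 1 n n) = 1" by simp
qed

end
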